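(* There is a monotone Boolean circuit computing $T_2(x_1,\dots,x_n)$ with $2n + \sqrt{2n} + O(\sqrt[3]{n})$ gates.
   Context: $T_2(x_1,\dots,x_n)$ (the threshold-2 function) is true iff at least two of $x_1,\dots,x_n$ are true, i.e. the negation of $\mathsf{AtMostOne}(x_1,\dots,x_n)$. A monotone Boolean circuit uses only $\wedge$ and $\vee$ gates of fan-in two (no negations); its size is its number of gates. *)

theory Defs
  imports Complex_Main "HOL-Library.Landau_Symbols"
begin

definition T2 :: "bool list \<Rightarrow> bool" where
  "T2 xs \<longleftrightarrow> 2 \<le> card {i. i < length xs \<and> xs ! i}"

text \<open>
  A circuit on \<open>n\<close> inputs is a straight-line program, i.e. a DAG given in topological order.
  Its nodes are numbered: \<open>0, \<dots>, n - 1\<close> are the inputs and \<open>n + k\<close> is the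
  \<open>k\<close>-th gate (counting from \<open>0\<close>), whose two arguments must be earlier nodes.
  Arbitrary fan-out is allowed, and there are no constant inputs.
\<close>

datatype mgate = AND nat nat | OR nat nat

datatype mcircuit = MCircuit (gates: "mgate list") (out: nat)

fun args_below :: "nat \<Rightarrow> mgate \<Rightarrow> bool" where
  "args_below m (AND i j) \<longleftrightarrow> i < m \<and> j < m"
| "args_below m (OR i j) \<longleftrightarrow> i < m \<and> j < m"

definition wf_circuit :: "nat \<Rightarrow> mcircuit \<Rightarrow> bool" where
  "wf_circuit n c \<longleftrightarrow>
     (\<forall>k < length (gates c). args_below (n + k) (gates c ! k)) \<and>
     out c < n + length (gates c)"

definition circuit_size :: "mcircuit \<Rightarrow> nat" where
  "circuit_size c = length (gates c)"

fun gate_value :: "bool list \<Rightarrow> mgate \<Rightarrow> bool" where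
  "gate_value vs (AND i j) \<longleftrightarrow> vs ! i \<and> vs ! j"
| "gate_value vs (OR i j) \<longleftrightarrow> vs ! i \<or> vs ! j"

fun node_values :: "bool list \<Rightarrow> mgate list \<Rightarrow> bool list" where
  "node_values vs [] = vs"
| "node_values vs (g # gs) = node_values (vs @ [gate_value vs g]) gs"

definition circuit_value :: "mcircuit \<Rightarrow> bool list \<Rightarrow> bool" where
  "circuit_value c xs = node_values xs (gates c) ! out c"

definition computes :: "nat \<Rightarrow> mcircuit \<Rightarrow> (bool list \<Rightarrow> bool) \<Rightarrow> bool" where
  "computes n c f \<longleftrightarrow>
     wf_circuit n c \<and> (\<forall>xs. length xs = n \<longrightarrow> circuit_value c xs = f xs)"

end

theory Submission
  imports Defs
begin

text \<open>
  Take a graph whose vertices are the points \<open>(a, j, c)\<close> of a cube of side \<open>t\<close>, two vertices being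
  adjacent when their middle coordinates differ, and place the \<open>n\<close> variables on distinct edges.
  The disjunctions \<open>y\<^sub>v\<close> of the variables on the edges at \<open>v\<close> cost \<open>2n - |V|\<close> gates. One true
  variable makes exactly two \<open>y\<^sub>v\<close> true, two true variables make at least three true. Project the
  true vertices to \<open>(a, j)\<close> and to \<open>(j, c)\<close>; the disjunctions cost at most \<open>2|V|\<close> gates. If both
  projections of a vertex set containing an edge have at most two elements, then each projection
  shows exactly the two distinct values of \<open>j\<close> on that edge, so \<open>j\<close> determines both \<open>a\<close> and \<open>c\<close>,
  and there are only two vertices. Hence \<open>T\<^sub>2\<close> of the variables is the disjunction of \<open>T\<^sub>3\<close> of the
  two projections, and each \<open>T\<^sub>3\<close> costs \<open>O(t\<^sup>2)\<close> gates. Since there are about \<open>t\<^sup>6 / 2\<close> edges,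
  \<open>|V| = t\<^sup>3\<close> can be taken to be \<open>\<surd>(2n) + O(n\<^bsup>1/3\<^esup>)\<close>.
\<close>

section \<open>Gate counts for sets of functions\<close>

definition wf_gates :: "nat \<Rightarrow> mgate list \<Rightarrow> bool" where
  "wf_gates n gs \<longleftrightarrow> (\<forall>k < length gs. args_below (n + k) (gs ! k))"

text \<open>There are no constant inputs, so the constantly false function is declared to be free.\<close>

definition available :: "nat \<Rightarrow> mgate list \<Rightarrow> (bool list \<Rightarrow> bool) \<Rightarrow> bool" where
  "available n gs f \<longleftrightarrow>
     (\<exists>i < n + length gs. \<forall>xs. length xs = n \<longrightarrow> node_values xs gs ! i = f xs) \<or>
     (\<forall>xs. length xs = n \<longrightarrow> \<not> f xs)"

text \<open>One gate list serves all of \<open>F\<close>, so a function used several times is paid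
  for once.\<close>

definition realizable :: "nat \<Rightarrow> nat \<Rightarrow> (bool list \<Rightarrow> bool) set \<Rightarrow> bool" where
  "realizable n k F \<longleftrightarrow>
     (\<exists>gs. length gs \<le> k \<and> wf_gates n gs \<and> (\<forall>f\<in>F. available n gs f))"

lemma length_node_values [simp]: "length (node_values vs gs) = length vs + length gs"
  by (induction gs arbitrary: vs) auto

lemma node_values_append: "node_values vs (gs @ hs) = node_values (node_values vs gs) hs"
  by (induction gs arbitrary: vs) auto

lemma node_values_snoc:
  "node_values vs (gs @ [g]) = node_values vs gs @ [gate_value (node_values vs gs) g]"
  by (simp add: node_values_append)

lemma wf_gates_snoc:
  "wf_gates n gs \<Longrightarrow> args_below (n + length gs) g \<Longrightarrow> wf_gates n (gs @ [g])"
  by (auto simp: wf_gates_def nth_append less_Suc_eq)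

lemma available_snoc:
  assumes "available n gs f"
  shows "available n (gs @ [g]) f"
proof (cases "\<forall>xs. length xs = n \<longrightarrow> \<not> f xs")
  case True
  then show ?thesis by (simp add: available_def)
next
  case False
  with assms obtain i where "i < n + length gs"
    "\<forall>xs. length xs = n \<longrightarrow> node_values xs gs ! i = f xs"
    by (auto simp: available_def)
  then show ?thesis
    unfolding available_def by (intro disjI1 exI[of _ i]) (auto simp: node_values_snoc nth_append)
qed

lemma available_cong:
  "(\<And>xs. length xs = n \<Longrightarrow> f xs = g xs) \<Longrightarrow> available n gs f = available n gs g"
  by (auto simp: available_def)

lemma realizable_mono: "realizable n k F \<Longrightarrow> k \<le> l \<Longrightarrow> G \<subseteq> F \<Longrightarrow> realizable n l G"
  unfolding realizable_def by (meson le_trans subsetD)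

lemma realizable_inputs: "realizable n 0 ((\<lambda>i xs. xs ! i) ` {..<n})"
  unfolding realizable_def by (intro exI[of _ "[]"]) (auto simp: wf_gates_def available_def)

text \<open>The alternative without a new gate covers the free constant false: it has no node, so a
  gate cannot refer to it.\<close>

lemma realizable_insert:
  assumes "realizable n k F"
    and "\<And>gs. wf_gates n gs \<Longrightarrow> \<forall>f\<in>F. available n gs f \<Longrightarrow>
           available n gs h \<or> (\<exists>g. args_below (n + length gs) g \<and> available n (gs @ [g]) h)"
  shows "realizable n (Suc k) (insert h F)"
proof -
  obtain gs where gs: "length gs \<le> k" "wf_gates n gs" "\<forall>f\<in>F. available n gs f"
    using assms(1) by (auto simp: realizable_def)
  from assms(2)[OF gs(2,3)] show ?thesis
  proof
    assume "available n gs h"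
    with gs show ?thesis unfolding realizable_def by (intro exI[of _ gs]) auto
  next
    assume "\<exists>g. args_below (n + length gs) g \<and> available n (gs @ [g]) h"
    then obtain g where g: "args_below (n + length gs) g" "available n (gs @ [g]) h"
      by blast
    then show ?thesis
      using gs unfolding realizable_def
      by (intro exI[of _ "gs @ [g]"]) (auto intro: wf_gates_snoc available_snoc)
  qed
qed

lemma realizable_or:
  assumes "realizable n k F" "f \<in> F" "g \<in> F"
  shows "realizable n (Suc k) (insert (\<lambda>xs. f xs \<or> g xs) F)"
proof (rule realizable_insert[OF assms(1)])
  fix gs
  assume "\<forall>f\<in>F. available n gs f"
  with assms have av: "available n gs f" "available n gs g" by auto
  consider "\<forall>xs. length xs = n \<longrightarrow> \<not> f xs" | "\<forall>xs. length xs = n \<longrightarrow> \<not> g xs"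
    | i j where "i < n + length gs" "\<forall>xs. length xs = n \<longrightarrow> node_values xs gs ! i = f xs"
        "j < n + length gs" "\<forall>xs. length xs = n \<longrightarrow> node_values xs gs ! j = g xs"
    using av unfolding available_def by blast
  then show "available n gs (\<lambda>xs. f xs \<or> g xs) \<or>
      (\<exists>h. args_below (n + length gs) h \<and> available n (gs @ [h]) (\<lambda>xs. f xs \<or> g xs))"
  proof cases
    case 1
    then have "available n gs (\<lambda>xs. f xs \<or> g xs) = available n gs g"
      by (intro available_cong) auto
    with av show ?thesis by simp
  next
    case 2
    then have "available n gs (\<lambda>xs. f xs \<or> g xs) = available n gs f"
      by (intro available_cong) auto
    with av show ?thesis by simp
  next
    case 3
    then have "available n (gs @ [OR i j]) (\<lambda>xs. f xs \<or> g xs)"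
      unfolding available_def
      by (intro disjI1 exI[of _ "n + length gs"]) (auto simp: node_values_snoc nth_append)
    with 3 show ?thesis by (intro disjI2 exI[of _ "OR i j"]) auto
  qed
qed

lemma realizable_and:
  assumes "realizable n k F" "f \<in> F" "g \<in> F"
  shows "realizable n (Suc k) (insert (\<lambda>xs. f xs \<and> g xs) F)"
proof (rule realizable_insert[OF assms(1)])
  fix gs
  assume "\<forall>f\<in>F. available n gs f"
  with assms have av: "available n gs f" "available n gs g" by auto
  consider "\<forall>xs. length xs = n \<longrightarrow> \<not> (f xs \<and> g xs)"
    | i j where "i < n + length gs" "\<forall>xs. length xs = n \<longrightarrow> node_values xs gs ! i = f xs"
        "j < n + length gs" "\<forall>xs. length xs = n \<longrightarrow> node_values xs gs ! j = g xs"
    using av unfolding available_def by blast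
  then show "available n gs (\<lambda>xs. f xs \<and> g xs) \<or>
      (\<exists>h. args_below (n + length gs) h \<and> available n (gs @ [h]) (\<lambda>xs. f xs \<and> g xs))"
  proof cases
    case 1
    then show ?thesis by (simp add: available_def)
  next
    case 2
    then have "available n (gs @ [AND i j]) (\<lambda>xs. f xs \<and> g xs)"
      unfolding available_def
      by (intro disjI1 exI[of _ "n + length gs"]) (auto simp: node_values_snoc nth_append)
    with 2 show ?thesis by (intro disjI2 exI[of _ "AND i j"]) auto
  qed
qed

lemma realizable_insert_False: "realizable n k F \<Longrightarrow> realizable n k (insert (\<lambda>_. False) F)"
  by (auto simp: realizable_def available_def)

section \<open>Disjunctions and the threshold 3\<close>

lemma realizable_Bex:
  assumes "finite I" "realizable n k F" "\<And>i. i \<in> I \<Longrightarrow> f i \<in> F"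
  shows "realizable n (k + (card I - 1)) (insert (\<lambda>xs. \<exists>i\<in>I. f i xs) F)"
  using assms(1,3)
proof (induction I rule: finite_induct)
  \<comment> \<open>The truncated \<open>card I - 1\<close> charges nothing here: the empty
    disjunction is the free constant false.\<close>
  case empty
  then show ?case using realizable_insert_False[OF assms(2)] by simp
next
  case (insert a I)
  show ?case
  proof (cases "I = {}")
    case True
    then show ?thesis using insert.prems assms(2) by (simp add: insert_absorb)
  next
    case False
    have "realizable n (k + (card I - 1)) (insert (\<lambda>xs. \<exists>i\<in>I. f i xs) F)"
      using insert by auto
    from realizable_or[OF this, of "f a" "\<lambda>xs. \<exists>i\<in>I. f i xs"] insert.prems
    have "realizable n (Suc (k + (card I - 1)))
        (insert (\<lambda>xs. f a xs \<or> (\<exists>i\<in>I. f i xs)) (insert (\<lambda>xs. \<exists>i\<in>I. f i xs) F))"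
      by auto
    moreover have "card I > 0"
      using False insert.hyps by (simp add: card_gt_0_iff)
    ultimately show ?thesis
      using insert.hyps by (elim realizable_mono) (simp, blast)
  qed
qed

lemma realizable_Bex_family:
  assumes "finite V" "\<And>v. v \<in> V \<Longrightarrow> finite (I v)" "realizable n k F"
    and "\<And>v i. v \<in> V \<Longrightarrow> i \<in> I v \<Longrightarrow> f i \<in> F"
  shows "realizable n (k + (\<Sum>v\<in>V. card (I v) - 1)) (F \<union> (\<lambda>v xs. \<exists>i\<in>I v. f i xs) ` V)"
  using assms(1,2,4)
proof (induction V rule: finite_induct)
  case empty
  then show ?case using assms(3) by simp
next
  case (insert a V)
  have "realizable n (k + (\<Sum>v\<in>V. card (I v) - 1)) (F \<union> (\<lambda>v xs. \<exists>i\<in>I v. f i xs) ` V)"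
    using insert by auto
  then have "realizable n (k + (\<Sum>v\<in>V. card (I v) - 1) + (card (I a) - 1))
      (insert (\<lambda>xs. \<exists>i\<in>I a. f i xs) (F \<union> (\<lambda>v xs. \<exists>i\<in>I v. f i xs) ` V))"
    using insert.prems by (intro realizable_Bex) auto
  then show ?case
    using insert.hyps by (elim realizable_mono) auto
qed

text \<open>Run through \<open>S\<close>, carrying the thresholds 1, 2 and 3 of the part seen so
  far. A new element costs one OR for threshold 1, and one AND and one OR for each of the thresholds
  2 and 3.\<close>

lemma realizable_threshold3:
  assumes "finite S" "realizable n k F" "\<And>s. s \<in> S \<Longrightarrow> f s \<in> F"
  shows "realizable n (k + 5 * card S) (insert (\<lambda>xs. 3 \<le> card {s \<in> S. f s xs}) F)"
proof -
  define T where "T S r xs \<longleftrightarrow> r \<le> card {s \<in> S. f s xs}" for S and r :: nat and xs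
  have "realizable n (k + 5 * card S) ({T S 1, T S 2, T S 3} \<union> F)"
    if "finite S" "S \<subseteq> {s. f s \<in> F}" for S
    using that
  proof (induction S rule: finite_induct)
    case empty
    have "T {} r = (\<lambda>_. False)" if "r > 0" for r
      using that by (auto simp: T_def fun_eq_iff)
    then show ?case
      using realizable_insert_False[OF assms(2)] by simp
  next
    case (insert a S)
    have step: "T (insert a S) (Suc r) = (\<lambda>xs. T S (Suc r) xs \<or> (T S r xs \<and> f a xs))" for r
    proof
      fix xs
      have "{s \<in> insert a S. f s xs} =
          (if f a xs then insert a {s \<in> S. f s xs} else {s \<in> S. f s xs})"
        by auto
      then have "card {s \<in> insert a S. f s xs} = card {s \<in> S. f s xs} + (if f a xs then 1 else 0)"
        using insert.hyps by auto
      then show "T (insert a S) (Suc r) xs = (T S (Suc r) xs \<or> (T S r xs \<and> f a xs))"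
        by (auto simp: T_def)
    qed
    \<comment> \<open>For \<open>r = 0\<close> the conjunction in \<open>step\<close> collapses to
      \<open>f a\<close>, so five gates suffice instead of six.\<close>
    have T0: "T S 0 = (\<lambda>_. True)"
      by (auto simp: T_def)
    have t1: "T (insert a S) 1 = (\<lambda>xs. T S 1 xs \<or> f a xs)"
      and t2: "T (insert a S) 2 = (\<lambda>xs. T S 2 xs \<or> (T S 1 xs \<and> f a xs))"
      and t3: "T (insert a S) 3 = (\<lambda>xs. T S 3 xs \<or> (T S 2 xs \<and> f a xs))"
      using step[of 0] step[of 1] step[of 2] by (simp_all add: T0 numeral_2_eq_2 numeral_3_eq_3)
    have fa: "f a \<in> F" using insert.prems by auto
    let ?G = "{T S 1, T S 2, T S 3} \<union> F"
    have G: "realizable n (k + 5 * card S) ?G"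
      using insert by auto
    have "realizable n (Suc (Suc (Suc (Suc (Suc (k + 5 * card S))))))
      (insert (\<lambda>xs. T S 1 xs \<or> f a xs) (insert (\<lambda>xs. T S 2 xs \<or> (T S 1 xs \<and> f a xs))
      (insert (\<lambda>xs. T S 1 xs \<and> f a xs) (insert (\<lambda>xs. T S 3 xs \<or> (T S 2 xs \<and> f a xs))
      (insert (\<lambda>xs. T S 2 xs \<and> f a xs) ?G)))))"
      by (intro realizable_or realizable_and G) (simp_all add: fa)
    then show ?case
      unfolding t1 t2 t3 using insert.hyps by (elim realizable_mono) auto
  qed
  from this[of S] assms have "realizable n (k + 5 * card S) ({T S 1, T S 2, T S 3} \<union> F)"
    by auto
  then show ?thesis
    unfolding T_def by (elim realizable_mono) auto
qed

text \<open>An input \<open>xs\<close> with \<open>f xs\<close> excludes the free constant false, so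
  \<open>f\<close> really sits at a node.\<close>

lemma realizable_computes:
  assumes "realizable n k F" "f \<in> F" "length xs = n" "f xs"
  shows "\<exists>c. computes n c f \<and> circuit_size c \<le> k"
proof -
  obtain gs where gs: "length gs \<le> k" "wf_gates n gs" "available n gs f"
    using assms by (auto simp: realizable_def)
  then obtain i where "i < n + length gs"
    "\<forall>xs. length xs = n \<longrightarrow> node_values xs gs ! i = f xs"
    using assms(3,4) by (auto simp: available_def)
  with gs show ?thesis
    by (intro exI[of _ "MCircuit gs i"])
      (auto simp: computes_def wf_circuit_def wf_gates_def circuit_value_def circuit_size_def)
qed

section \<open>Two edges seen through two projections\<close>

text \<open>Here \<open>X\<close> stands for the true variables and \<open>p i\<close>,
  \<open>q i\<close> for the ends of edge \<open>i\<close>, oriented by increasing middle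
  coordinate. Both projections retain that coordinate, hence separate the ends of every
  edge.\<close>

lemma two_edges_iff_three_projections:
  fixes X :: "nat set" and p q :: "nat \<Rightarrow> 'a \<times> 'b :: linorder \<times> 'c"
  defines "Y \<equiv> p ` X \<union> q ` X"
  assumes "finite X" and inj: "inj_on (\<lambda>i. (p i, q i)) X"
    and less: "\<And>i. i \<in> X \<Longrightarrow> fst (snd (p i)) < fst (snd (q i))"
  shows "2 \<le> card X \<longleftrightarrow>
    3 \<le> card ((\<lambda>(a, j, c). (a, j)) ` Y) \<or> 3 \<le> card ((\<lambda>(a, j, c). (j, c)) ` Y)"
    (is "_ \<longleftrightarrow> 3 \<le> card (?f ` Y) \<or> 3 \<le> card (?g ` Y)")
proof
  have finY: "finite Y" unfolding Y_def using \<open>finite X\<close> by simp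
  {
    assume "3 \<le> card (?f ` Y) \<or> 3 \<le> card (?g ` Y)"
    then have "3 \<le> card Y"
      using card_image_le[OF finY] by (meson le_trans)
    moreover have "card Y \<le> card X + card X"
      unfolding Y_def
      by (rule order_trans[OF card_Un_le]) (intro add_mono card_image_le \<open>finite X\<close>)
    ultimately show "2 \<le> card X" by linarith
  next
    assume "2 \<le> card X"
    then obtain i i' where i: "i \<in> X" "i' \<in> X" "i \<noteq> i'"
      by (metis card_le_Suc0_iff_eq \<open>finite X\<close> not_less_eq_eq numeral_2_eq_2)
    show "3 \<le> card (?f ` Y) \<or> 3 \<le> card (?g ` Y)"
    proof (rule ccontr)
      assume "\<not> (3 \<le> card (?f ` Y) \<or> 3 \<le> card (?g ` Y))"
      then have le: "card (?f ` Y) \<le> 2" "card (?g ` Y) \<le> 2" by auto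
      have pq: "p i \<in> Y" "q i \<in> Y" using i by (auto simp: Y_def)
      \<comment> \<open>The ends of one edge already exhaust an image of size at most 2.\<close>
      have two: "h ` Y = {h (p i), h (q i)}"
        if "card (h ` Y) \<le> 2" "h (p i) \<noteq> h (q i)" for h :: "'a \<times> 'b \<times> 'c \<Rightarrow> 'd"
      proof (rule sym, rule card_seteq)
        show "finite (h ` Y)" using finY by simp
        show "{h (p i), h (q i)} \<subseteq> h ` Y" using pq by auto
        show "card (h ` Y) \<le> card {h (p i), h (q i)}" using that by simp
      qed
      have ne: "fst (snd (p i)) \<noteq> fst (snd (q i))" using less[OF i(1)] by simp
      have f: "?f ` Y = {?f (p i), ?f (q i)}"
        using ne by (intro two le) (auto split: prod.splits)
      have g: "?g ` Y = {?g (p i), ?g (q i)}"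
        using ne by (intro two le) (auto split: prod.splits)
      \<comment> \<open>The middle coordinate of \<open>y\<close> selects the same end of edge
        \<open>i\<close> in both projections; one then fixes the first coordinate, the other the
        third.\<close>
      have Y: "y = p i \<or> y = q i" if "y \<in> Y" for y
      proof -
        have "?f y \<in> {?f (p i), ?f (q i)}" "?g y \<in> {?g (p i), ?g (q i)}"
          using f g that by blast+
        then show ?thesis using ne by (auto split: prod.splits)
      qed
      \<comment> \<open>Both ends of edge \<open>i'\<close> are ends of edge \<open>i\<close>, and
        the orientation forbids a swap, so the edges coincide.\<close>
      have "p i' \<in> Y" "q i' \<in> Y" using i by (auto simp: Y_def)
      then have "p i' = p i \<and> q i' = q i"
        using Y[of "p i'"] Y[of "q i'"] less[OF i(1)] less[OF i(2)] by auto
      with i inj show False by (auto simp: inj_on_def)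
    qed
  }
qed

section \<open>From a placement of the variables on edges to a circuit\<close>

lemma sum_card_fibres:
  assumes "finite V"
  shows "(\<Sum>u\<in>h ` V. card {v \<in> V. h v = u}) = card V"
  using sum.image_gen[OF assms, of "\<lambda>_. 1::nat" h] by simp

lemma image_eq_fibres_meeting:
  "Y \<subseteq> V \<Longrightarrow> h ` Y = {u \<in> h ` V. \<exists>v\<in>{v \<in> V. h v = u}. v \<in> Y}"
  by auto (metis image_eqI)

text \<open>The vertex disjunctions \<open>y\<close> cost \<open>2 * n - card V\<close> gates and
  each of the two families \<open>z\<close> at most \<open>card V\<close>, together
  \<open>2 * n + card V\<close>. The two thresholds and one final OR complete the count.\<close>

lemma T2_circuit_from_edges:
  fixes n :: nat and p q :: "nat \<Rightarrow> nat \<times> nat \<times> nat"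
  defines "V \<equiv> p ` {..<n} \<union> q ` {..<n}"
  assumes "n \<ge> 2" and inj: "inj_on (\<lambda>i. (p i, q i)) {..<n}"
    and less: "\<And>i. i < n \<Longrightarrow> fst (snd (p i)) < fst (snd (q i))"
  shows "\<exists>c. computes n c T2 \<and> circuit_size c \<le> 2 * n + card V +
    5 * card ((\<lambda>(a, j, c). (a, j)) ` V) + 5 * card ((\<lambda>(a, j, c). (j, c)) ` V) + 1"
proof -
  let ?f = "\<lambda>(a, j, c). (a, j) :: nat \<times> nat" and ?g = "\<lambda>(a, j, c). (j, c) :: nat \<times> nat"
  have finV: "finite V" by (simp add: V_def)
  define I where "I v = {i. i < n \<and> (p i = v \<or> q i = v)}" for v
  define y where "y v = (\<lambda>xs :: bool list. \<exists>i\<in>I v. xs ! i)" for v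
  define fib where "fib h u = {v \<in> V. h v = u}" for h :: "nat \<times> nat \<times> nat \<Rightarrow> nat \<times> nat" and u
  define z where "z h u = (\<lambda>xs. \<exists>v\<in>fib h u. y v xs)" for h u
  have finI: "finite (I v)" for v by (simp add: I_def)
  have fin_fib: "finite (fib h u)" for h u using finV by (simp add: fib_def)
  \<comment> \<open>Double counting of incidences: each edge has two distinct ends, and every vertex
    of \<open>V\<close> lies on an edge, so no subtraction is truncated.\<close>
  have sum_y: "(\<Sum>v\<in>V. card (I v) - 1) + card V = 2 * n"
  proof -
    have pos: "card (I v) > 0" if "v \<in> V" for v
      using that finI[of v] by (auto simp: V_def I_def card_gt_0_iff)
    have "(\<Sum>v\<in>V. card (I v) - 1) + card V = (\<Sum>v\<in>V. card (I v) - 1 + 1)"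
      by (subst sum.distrib) simp
    also have "\<dots> = (\<Sum>v\<in>V. card (I v))"
      using pos by (intro sum.cong) (auto simp: Suc_le_eq)
    also have "\<dots> = (\<Sum>v\<in>V. card {i\<in>{..<n}. p i = v \<or> q i = v})"
      by (simp add: I_def)
    also have "\<dots> = (\<Sum>i<n. card {v \<in> V. p i = v \<or> q i = v})"
      by (rule sum_multicount_gen) (use finV in auto)
    also have "\<dots> = (\<Sum>i<n. 2)"
    proof (rule sum.cong)
      fix i assume "i \<in> {..<n}"
      then have "{v \<in> V. p i = v \<or> q i = v} = {p i, q i}" "p i \<noteq> q i"
        using less[of i] by (auto simp: V_def)
      then show "card {v \<in> V. p i = v \<or> q i = v} = 2" by simp
    qed simp
    finally show ?thesis by simp
  qed
  have sum_z: "(\<Sum>u\<in>h ` V. card (fib h u) - 1) \<le> card V" for h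
  proof -
    have "(\<Sum>u\<in>h ` V. card (fib h u) - 1) \<le> (\<Sum>u\<in>h ` V. card (fib h u))"
      by (intro sum_mono) simp
    then show ?thesis unfolding fib_def sum_card_fibres[OF finV] .
  qed
  let ?X = "(\<lambda>i xs. xs ! i) ` {..<n}"
  have r1: "realizable n (\<Sum>v\<in>V. card (I v) - 1) (?X \<union> y ` V)"
    using realizable_Bex_family[OF finV finI realizable_inputs, where f = "\<lambda>i xs. xs ! i"]
    by (simp add: y_def I_def)
  have r2: "realizable n ((\<Sum>v\<in>V. card (I v) - 1) + card V + card V)
      (?X \<union> y ` V \<union> z ?f ` ?f ` V \<union> z ?g ` ?g ` V)"
  proof -
    have rz: "realizable n (k + card V) (F \<union> z h ` h ` V)"
      if "realizable n k F" "y ` V \<subseteq> F" for k F h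
    proof -
      have "realizable n (k + (\<Sum>u\<in>h ` V. card (fib h u) - 1)) (F \<union> z h ` h ` V)"
        unfolding z_def
        by (rule realizable_Bex_family) (use that finV fin_fib in \<open>auto simp: fib_def\<close>)
      then show ?thesis using sum_z[of h] by (elim realizable_mono) auto
    qed
    show ?thesis by (intro rz r1) auto
  qed
  define F where "F = ?X \<union> y ` V \<union> z ?f ` ?f ` V \<union> z ?g ` ?g ` V"
  define T where "T h = (\<lambda>xs. 3 \<le> card {u \<in> h ` V. z h u xs})" for h
  have r3: "realizable n (2 * n + card V + 5 * card (?f ` V) + 5 * card (?g ` V))
      (insert (T ?g) (insert (T ?f) F))"
  proof -
    have "realizable n (2 * n + card V) F"
      using r2 unfolding F_def sum_y .
    then show ?thesis
      unfolding T_def by (intro realizable_threshold3) (auto simp: finV F_def)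
  qed
  have r4: "realizable n (Suc (2 * n + card V + 5 * card (?f ` V) + 5 * card (?g ` V)))
      (insert (\<lambda>xs. T ?f xs \<or> T ?g xs) (insert (T ?g) (insert (T ?f) F)))"
    using r3 by (rule realizable_or) auto
  have T2_eq: "(T ?f xs \<or> T ?g xs) = T2 xs" if "length xs = n" for xs
  proof -
    define X where "X = {i. i < n \<and> xs ! i}"
    define Y where "Y = p ` X \<union> q ` X"
    have y: "y v xs \<longleftrightarrow> v \<in> Y" for v
    proof
      assume "y v xs"
      then obtain i where "i \<in> X" "p i = v \<or> q i = v"
        by (auto simp: y_def I_def X_def)
      then show "v \<in> Y" unfolding Y_def by blast
    next
      assume "v \<in> Y"
      then obtain i where "i \<in> X" "p i = v \<or> q i = v"
        unfolding Y_def by blast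
      then show "y v xs" by (auto simp: y_def I_def X_def)
    qed
    have "X \<subseteq> {..<n}" by (auto simp: X_def)
    then have "Y \<subseteq> V"
      unfolding Y_def V_def by (intro Un_mono image_mono)
    then have "{u \<in> h ` V. z h u xs} = h ` Y" for h
      unfolding z_def fib_def y by (rule image_eq_fibres_meeting[symmetric])
    moreover have "2 \<le> card X \<longleftrightarrow> 3 \<le> card (?f ` Y) \<or> 3 \<le> card (?g ` Y)"
      unfolding Y_def
      by (rule two_edges_iff_three_projections)
        (use less \<open>X \<subseteq> {..<n}\<close> in \<open>auto intro: inj_on_subset[OF inj] finite_subset\<close>)
    ultimately show ?thesis
      using that by (simp add: T_def T2_def X_def)
  qed
  \<comment> \<open>The all-true input is the witness that the output is not constantly false; this
    is where \<open>n \<ge> 2\<close> enters.\<close>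
  have "{i. i < n \<and> replicate n True ! i} = {..<n}" by auto
  then have "T2 (replicate n True)"
    using \<open>n \<ge> 2\<close> by (simp add: T2_def)
  then have "T ?f (replicate n True) \<or> T ?g (replicate n True)"
    using T2_eq[OF length_replicate] by blast
  then obtain c where c: "computes n c (\<lambda>xs. T ?f xs \<or> T ?g xs)"
    "circuit_size c \<le> Suc (2 * n + card V + 5 * card (?f ` V) + 5 * card (?g ` V))"
    using realizable_computes[OF r4, of "\<lambda>xs. T ?f xs \<or> T ?g xs" "replicate n True"] by auto
  have "computes n c T2"
    using c(1) T2_eq unfolding computes_def by metis
  with c(2) show ?thesis by auto
qed

section \<open>Edges of the cube and the choice of its side\<close>

lemma card_ordered_pairs: "2 * card {(i, j). i < j \<and> j < (t :: nat)} = t * (t - 1)"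
proof -
  have "{(i, j). i < j \<and> j < t} = prod.swap ` (SIGMA j:{..<t}. {..<j})"
    by auto
  then have "card {(i, j). i < j \<and> j < t} = (\<Sum>j<t. j)"
    by (simp add: card_image)
  moreover have "even (t * (t - 1))"
    by (cases t) auto
  ultimately show ?thesis
    using Sum_Ico_nat[of 0 t] by (simp add: lessThan_atLeast0)
qed

lemma T2_circuit_cube:
  assumes "n \<ge> 2" "2 * n \<le> t ^ 5 * (t - 1)"
  shows "\<exists>c. computes n c T2 \<and> circuit_size c \<le> 2 * n + t ^ 3 + 10 * t ^ 2 + 1"
proof -
  define J where "J = {(i, j). i < j \<and> j < t}"
  \<comment> \<open>An edge is stored coordinatewise, as pairs of first, middle and third
    coordinates of its ends; \<open>J\<close> orients it, so each edge occurs once. Any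
    \<open>n\<close> of these edges will do.\<close>
  define E where "E = ({..<t} \<times> {..<t}) \<times> J \<times> ({..<t} \<times> {..<t})"
  have "J \<subseteq> {..<t} \<times> {..<t}" by (auto simp: J_def)
  then have "finite J" by (rule finite_subset) simp
  then have "finite E" by (simp add: E_def)
  have "2 * card E = t ^ 4 * (2 * card J)"
    by (simp add: E_def card_cartesian_product power4_eq_xxxx)
  also have "\<dots> = t ^ 5 * (t - 1)"
    unfolding J_def card_ordered_pairs by (simp add: eval_nat_numeral)
  finally have "n \<le> card E" using assms by simp
  then obtain e where e: "inj_on e {..<n}" "e ` {..<n} \<subseteq> E"
    using card_le_inj[of "{..<n}" E] \<open>finite E\<close> by auto
  define p where "p i = (case e i of ((a, a'), (j, j'), (c, c')) \<Rightarrow> (a, j, c))" for i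
  define q where "q i = (case e i of ((a, a'), (j, j'), (c, c')) \<Rightarrow> (a', j', c'))" for i
  define V where "V = p ` {..<n} \<union> q ` {..<n}"
  have inj: "inj_on (\<lambda>i. (p i, q i)) {..<n}"
  proof (rule inj_onI)
    fix i i' assume "i \<in> {..<n}" "i' \<in> {..<n}" "(p i, q i) = (p i', q i')"
    moreover from this have "e i = e i'"
      by (auto simp: p_def q_def split: prod.splits)
    ultimately show "i = i'" using e(1) by (auto simp: inj_on_def)
  qed
  have mem: "e i \<in> E" if "i < n" for i using e(2) that by auto
  have less: "fst (snd (p i)) < fst (snd (q i))" if "i < n" for i
    using mem[OF that] by (auto simp: p_def q_def E_def J_def)
  have V: "V \<subseteq> {..<t} \<times> {..<t} \<times> {..<t}"
  proof -
    have "p i \<in> {..<t} \<times> {..<t} \<times> {..<t} \<and> q i \<in> {..<t} \<times> {..<t} \<times> {..<t}" if "i < n" for i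
      using mem[OF that] by (auto simp: p_def q_def E_def J_def)
    then show ?thesis unfolding V_def by blast
  qed
  have "card V \<le> card ({..<t} \<times> {..<t} \<times> {..<t})"
    using V by (intro card_mono) auto
  moreover have "card ((\<lambda>(a, j, c). (a, j)) ` V) \<le> card ({..<t} \<times> {..<t})"
    "card ((\<lambda>(a, j, c). (j, c)) ` V) \<le> card ({..<t} \<times> {..<t})"
    using V by (intro card_mono; auto)+
  ultimately have "card V \<le> t ^ 3" "card ((\<lambda>(a, j, c). (a, j)) ` V) \<le> t ^ 2"
    "card ((\<lambda>(a, j, c). (j, c)) ` V) \<le> t ^ 2"
    by (simp_all add: card_cartesian_product power2_eq_square power3_eq_cube)
  moreover obtain c where "computes n c T2" "circuit_size c \<le> 2 * n + card V +
    5 * card ((\<lambda>(a, j, c). (a, j)) ` V) + 5 * card ((\<lambda>(a, j, c). (j, c)) ` V) + 1"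
    using T2_circuit_from_edges[OF assms(1) inj less] unfolding V_def by blast
  ultimately show ?thesis by (intro exI[of _ c]) auto
qed

theorem theorem9:
  shows "\<exists>e :: nat \<Rightarrow> real. e \<in> O(\<lambda>n. root 3 (real n)) \<and>
    (\<forall>n\<ge>2. \<exists>c. computes n c T2 \<and>
       real (circuit_size c) \<le> 2 * real n + sqrt (2 * real n) + e n)"
\<comment> \<open>The constant is 16 + 52 + 49, the sum of the lower coefficients of
  \<open>(z + 2) ^ 3 + 10 * (z + 2) ^ 2 + 1\<close>, each lower power of \<open>z\<close> being at
  most \<open>z ^ 2\<close>.\<close>
proof (intro exI[of _ "\<lambda>n. 117 * root 3 (2 * real n)"] conjI allI impI)
  show "(\<lambda>n. 117 * root 3 (2 * real n)) \<in> O(\<lambda>n. root 3 (real n))"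
    by (simp add: real_root_mult)
next
  fix n :: nat
  assume n: "n \<ge> 2"
  \<comment> \<open>The sixth root makes \<open>z ^ 3\<close> the square root and
    \<open>z ^ 2\<close> the cube root of \<open>2 * n\<close>. The \<open>+ 1\<close> in
    \<open>t\<close> ensures \<open>t - 1 \<ge> z\<close>, hence
    \<open>t ^ 5 * (t - 1) \<ge> z ^ 6\<close>.\<close>
  define z where "z = root 6 (2 * real n)"
  define t where "t = nat \<lceil>z\<rceil> + 1"
  have z1: "z \<ge> 1" using n by (simp add: z_def)
  have z6: "z ^ 6 = 2 * real n" by (simp add: z_def)
  have z2: "z ^ 2 = root 3 (2 * real n)"
    by (rule real_root_pos_unique[symmetric]) (use z1 z6 in \<open>auto simp flip: power_mult\<close>)
  have z3: "z ^ 3 = sqrt (2 * real n)"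
    by (rule real_sqrt_unique[symmetric]) (use z1 z6 in \<open>auto simp flip: power_mult\<close>)
  have t: "z \<le> real t - 1" "real t \<le> z + 2"
    using z1 unfolding t_def by linarith+
  have "2 * real n = z ^ 5 * z"
    using z6 by (simp add: eval_nat_numeral)
  also have "\<dots> \<le> real t ^ 5 * (real t - 1)"
    using t z1 by (intro mult_mono power_mono) auto
  also have "\<dots> = real (t ^ 5 * (t - 1))"
    by (simp add: t_def)
  finally have "2 * n \<le> t ^ 5 * (t - 1)"
    by linarith
  from T2_circuit_cube[OF n this] obtain c where c: "computes n c T2"
    "circuit_size c \<le> 2 * n + t ^ 3 + 10 * t ^ 2 + 1"
    by blast
  have "real (circuit_size c) \<le> real (2 * n + t ^ 3 + 10 * t ^ 2 + 1)"
    using c(2) by (rule of_nat_mono)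
  also have "\<dots> = 2 * real n + real t ^ 3 + 10 * real t ^ 2 + 1"
    by simp
  also have "\<dots> \<le> 2 * real n + (z + 2) ^ 3 + 10 * (z + 2) ^ 2 + 1"
    using t by (intro add_mono mult_left_mono power_mono) auto
  also have "\<dots> = 2 * real n + z ^ 3 + 16 * z ^ 2 + 52 * z + 49"
    by (simp add: power2_eq_square power3_eq_cube algebra_simps)
  also have "\<dots> \<le> 2 * real n + z ^ 3 + 117 * z ^ 2"
  proof -
    have "z \<le> z ^ 2" "1 \<le> z ^ 2" using z1 by (auto intro: self_le_power)
    then show ?thesis by linarith
  qed
  finally show "\<exists>c. computes n c T2 \<and> real (circuit_size c)
      \<le> 2 * real n + sqrt (2 * real n) + 117 * root 3 (2 * real n)"
    using c(1) z2 z3 by auto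
qed

end
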